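(* Let $N$ be a finite set of $n$ agents and $A$ a finite set of $m$ object types with quotas $(q_a)_{a\in A}$ satisfying $\sum_{a\in A}q_a\ge n$. A rule $\varphi:\mathscr{P}^{n}\to\Pi$ satisfies sd-rank-fairness and equal-rank envy-freeness if and only if $\varphi=\varphi^{pr}$, where $\varphi^{pr}$ is the probabilistic rank rule.
   Context: **Model.** $N=\{1,\dots,n\}$ is a finite set of agents and $A=\{a_1,\dots,a_m\}$ a finite set of object types. Each $a\in A$ has a supply (quota, number of copies) $q_a$, a positive integer, and $\sum_{a\in A}q_a\ge n$. $N$, $A$ and $(q_a)_{a\in A}$ are fixed. $\mathscr{P}$ is the set of all strict preferences (strict linear orders) on $A$. A preference profile is $P=(P_1,\dots,P_n)\in\mathscr{P}^n$, where $a\,P_i\,b$ means that agent $i$ strictly prefers $a$ to $b$. The rank of $a$ at $P_i$ is $P_i(a)=l$ if $a$ is the $l$-th choice of $i$ under $P_i$ (so the favorite object has rank 1). Let $U(P_i,a)=\{b\in A: b\,P_i\,a\}$ and $\widehat U(P_i,a)=U(P_i,a)\cup\{a\}$. A random assignment is an $n\times m$ matrix $\pi=(\pi_{ia})$ with nonnegative entries such that $\sum_{a\in A}\pi_{ia}=1$ for each $i\in N$ and $\sum_{i\in N}\pi_{ia}\le q_a$ for each $a\in A$. $\Pi$ is the set of all random assignments. A rule is a mapping $\varphi:\mathscr{P}^n\to\Pi$; $\varphi_{ia}(P)$ denotes the $(i,a)$ entry of $\varphi(P)$. **Sd-rank-fairness.** $\varphi$ satisfies sd-rank-fairness if for each $P\in\mathscr{P}^n$,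 $i\in N$ and $a\in A$, $\varphi_{ia}(P)>0$ implies (i) $\sum_{j\in N}\varphi_{ja'}(P)=q_{a'}$ for all $a'$ such that $a'\,P_i\,a$; and (ii) $\sum_{a'\in\widehat U(P_j,a)}\varphi_{ja'}(P)=1$ for each $j\in N$ such that $P_j(a)<P_i(a)$. **Equal-rank envy-freeness.** $\varphi$ satisfies equal-rank envy-freeness if for each $P\in\mathscr{P}^n$, each $a\in A$ and all $i,j\in N$ such that $P_i(a)=P_j(a)$, $$\min\Big(\sum_{a'\in U(P_i,a)}\varphi_{ia'}(P)+\varphi_{ja}(P),\,1\Big)\le\sum_{a'\in\widehat U(P_i,a)}\varphi_{ia'}(P).$$ **Probabilistic rank (PR) rule $\varphi^{pr}$.** For each $P$, $\varphi^{pr}(P)$ is the outcome of the following algorithm. In step $k=1,2,\dots$, only the $k$-th choices of the remaining (not yet satiated) agents are considered: all remaining agents simultaneously and at equal speeds consume their $k$-th choice objects, each agent consuming until the quota of that object is exhausted or she is satiated (her total consumption over all steps equals 1). Satiated agents are then removed. The algorithm ends when every agent has been assigned one unit in total. Explicitly, at step $k$ let $r_i\in[0,1]$ be 1 minus the total consumption of agent $i$ in steps $1,\dots,k-1$, and let $s_a$ be $q_a$ minus the total amount of $a$ consumed in steps $1,\dots,k-1$. For each $a\in A$ put $I(a,k)=\{j\in N:P_j(a)=k\}$. If $\sum_{j\in I(a,k)}r_j\le s_a$, then $\varphi^{pr}_{ia}(P)=r_i$ for every $i\in I(a,k)$; otherwise $\varphi^{pr}_{ia}(P)=\min(r_i,\lambda)$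 for every $i\in I(a,k)$, where $\lambda\ge 0$ is the number such that $\sum_{j\in I(a,k)}\min(r_j,\lambda)=s_a$. *)

theory Defs
  imports "HOL-Analysis.Analysis"
begin

text \<open>
  Agents are the elements of a finite type \<open>'i\<close>, object types those of a finite type \<open>'a\<close>;
  \<open>q a\<close> is the supply of \<open>a\<close>.  A pair \<open>(a, b)\<close> in a preference
  means that \<open>a\<close> is strictly preferred to \<open>b\<close>.
\<close>

typedef 'a pref = "{R :: 'a rel. strict_linear_order R}"
proof -
  obtain R :: "'a rel" where "well_order_on UNIV R"
    using well_order_on by blast
  then have "strict_linear_order (R - Id)"
    using strict_linear_order_on_diff_Id by (auto simp: well_order_on_def)
  then show ?thesis by blast
qed

definition prefers :: "'a pref \<Rightarrow> 'a \<Rightarrow> 'a \<Rightarrow> bool" where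
  "prefers p a b \<longleftrightarrow> (a, b) \<in> Rep_pref p"

definition upper :: "'a pref \<Rightarrow> 'a \<Rightarrow> 'a set" where
  "upper p a = {b. prefers p b a}"

definition upper_eq :: "'a pref \<Rightarrow> 'a \<Rightarrow> 'a set" where
  "upper_eq p a = upper p a \<union> {a}"

definition pref_rank :: "'a::finite pref \<Rightarrow> 'a \<Rightarrow> nat" where
  "pref_rank p a = card (upper p a) + 1"

type_synonym ('i, 'a) profile = "'i \<Rightarrow> 'a pref"
type_synonym ('i, 'a) assignment = "'i \<Rightarrow> 'a \<Rightarrow> real"
type_synonym ('i, 'a) rule = "('i, 'a) profile \<Rightarrow> ('i, 'a) assignment"

definition random_assignments :: "('a::finite \<Rightarrow> nat) \<Rightarrow> ('i::finite, 'a) assignment set" where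
  "random_assignments q =
     {x. (\<forall>i a. 0 \<le> x i a) \<and> (\<forall>i. (\<Sum>a\<in>UNIV. x i a) = 1) \<and> (\<forall>a. (\<Sum>i\<in>UNIV. x i a) \<le> real (q a))}"

definition is_rule :: "('a::finite \<Rightarrow> nat) \<Rightarrow> ('i::finite, 'a) rule \<Rightarrow> bool" where
  "is_rule q \<phi> \<longleftrightarrow> (\<forall>P. \<phi> P \<in> random_assignments q)"

definition sd_rank_fair :: "('a::finite \<Rightarrow> nat) \<Rightarrow> ('i::finite, 'a) rule \<Rightarrow> bool" where
  "sd_rank_fair q \<phi> \<longleftrightarrow> (\<forall>P i a. \<phi> P i a > 0 \<longrightarrow>
     (\<forall>a'. prefers (P i) a' a \<longrightarrow> (\<Sum>j\<in>UNIV. \<phi> P j a') = real (q a')) \<and>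
     (\<forall>j. pref_rank (P j) a < pref_rank (P i) a \<longrightarrow> (\<Sum>a'\<in>upper_eq (P j) a. \<phi> P j a') = 1))"

definition equal_rank_envy_free :: "('i::finite, 'a::finite) rule \<Rightarrow> bool" where
  "equal_rank_envy_free \<phi> \<longleftrightarrow> (\<forall>P a i j. pref_rank (P i) a = pref_rank (P j) a \<longrightarrow>
     min ((\<Sum>a'\<in>upper (P i) a. \<phi> P i a') + \<phi> P j a) 1 \<le> (\<Sum>a'\<in>upper_eq (P i) a. \<phi> P i a'))"

text \<open>
  \<open>pr_share r s I i\<close> is what agent \<open>i \<in> I\<close> gets when the agents in \<open>I\<close>, with remaining demands
  \<open>r\<close>, eat at equal speeds from a remaining supply \<open>s\<close>.  The description operator is
  only used where it denotes, by \<open>pr_level_ex1\<close> below.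
\<close>

definition pr_share :: "('i \<Rightarrow> real) \<Rightarrow> real \<Rightarrow> 'i set \<Rightarrow> 'i \<Rightarrow> real" where
  "pr_share r s I i =
     (if (\<Sum>j\<in>I. r j) \<le> s then r i
      else min (r i) (THE l. l \<ge> 0 \<and> (\<Sum>j\<in>I. min (r j) l) = s))"

lemma pr_level_ex1:
  fixes r :: "'i \<Rightarrow> real"
  assumes fin: "finite I" and r: "\<And>j. j \<in> I \<Longrightarrow> 0 \<le> r j" and s: "0 \<le> s" "s < (\<Sum>j\<in>I. r j)"
  shows "\<exists>!l. l \<ge> 0 \<and> (\<Sum>j\<in>I. min (r j) l) = s"
proof -
  define f where "f l = (\<Sum>j\<in>I. min (r j) l)" for l
  have "f 0 = 0" unfolding f_def using r by (intro sum.neutral) auto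
  moreover have top: "f (\<Sum>j\<in>I. r j) = (\<Sum>j\<in>I. r j)"
    unfolding f_def
  proof (rule sum.cong[OF refl])
    fix j assume "j \<in> I"
    then have "r j \<le> (\<Sum>j\<in>I. r j)" using fin r by (intro member_le_sum) auto
    then show "min (r j) (\<Sum>j\<in>I. r j) = r j" by simp
  qed
  moreover have "continuous_on {0..\<Sum>j\<in>I. r j} f"
    unfolding f_def by (intro continuous_intros)
  ultimately obtain l where l: "0 \<le> l" "f l = s"
    using IVT'[of f 0 s "\<Sum>j\<in>I. r j"] s by auto
  have less: "f x < f y" if "x < y" "f x = s" for x y
  proof -
    have "\<exists>j\<in>I. x < r j"
    proof (rule ccontr)
      assume "\<not> ?thesis"
      then have "f x = (\<Sum>j\<in>I. r j)" unfolding f_def by (intro sum.cong) auto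
      with that s show False by simp
    qed
    then obtain j where j: "j \<in> I" "x < r j" by blast
    show ?thesis unfolding f_def
      using fin j that by (intro sum_strict_mono_ex1) (auto intro!: bexI[of _ j])
  qed
  have "l' = l" if "f l' = s" for l'
    using less[of l l'] less[of l' l] that l by (metis linorder_less_linear less_irrefl)
  with l show ?thesis unfolding f_def by blast
qed

text \<open>
  \<open>pr_upto q P k i a\<close> is the amount of \<open>a\<close> consumed by \<open>i\<close> in steps \<open>1, \<dots>, k\<close>.  Satiated agents
  need not be removed explicitly: their remaining demand, and hence their share, is \<open>0\<close>.
  For the same reason a step changes nothing once all agents are satiated, so running
  the algorithm through all \<open>CARD('a)\<close> ranks gives its outcome.
\<close>

primrec pr_upto :: "('a::finite \<Rightarrow> nat) \<Rightarrow> ('i::finite, 'a) profile \<Rightarrow> nat \<Rightarrow> ('i, 'a) assignment" where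
  "pr_upto q P 0 = (\<lambda>i a. 0)"
| "pr_upto q P (Suc k) = (\<lambda>i a.
     if pref_rank (P i) a = Suc k
     then pr_share (\<lambda>j. 1 - (\<Sum>b\<in>UNIV. pr_upto q P k j b))
            (real (q a) - (\<Sum>j\<in>UNIV. pr_upto q P k j a))
            {j. pref_rank (P j) a = Suc k} i
     else pr_upto q P k i a)"

definition pr_rule :: "('a::finite \<Rightarrow> nat) \<Rightarrow> ('i::finite, 'a) rule" where
  "pr_rule q = (\<lambda>P. pr_upto q P CARD('a))"

end

theory Submission
  imports Defs
begin

text \<open>
  Since ranks are processed in increasing order, the PR outcome at a profile is the only matrix
  \<open>x\<close> in which every object \<open>a\<close> is shared, among the agents ranking it \<open>k\<close>-th, by equal-speed
  eating from the demands and the supply that \<open>x\<close> leaves after the ranks below \<open>k\<close>.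
  An equal-speed division \<open>y\<close> is in turn characterised by two properties: it exhausts the
  supply unless everybody is satiated, and \<open>y i < y j\<close> only if \<open>i\<close> is satiated.  The second property
  is equal-rank envy-freeness.  Sd-rank-fairness gives the first: if \<open>j\<close> is unsatiated after
  \<open>a\<close>, then \<open>j\<close> receives something worse, so \<open>a\<close> is exhausted by (i), and nobody ranking \<open>a\<close> lower
  gets any of it by (ii).
\<close>

section \<open>Strict preferences and ranks\<close>

lemma strict_linear_order_Rep_pref: "strict_linear_order (Rep_pref p)"
  using Rep_pref[of p] by simp

lemma prefers_irrefl: "\<not> prefers p a a"
  using strict_linear_order_Rep_pref[of p]
  by (auto simp: prefers_def strict_linear_order_on_def irrefl_on_def)

lemma prefers_trans: "prefers p a b \<Longrightarrow> prefers p b c \<Longrightarrow> prefers p a c"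
  using strict_linear_order_Rep_pref[of p]
  unfolding prefers_def strict_linear_order_on_def by (blast dest: transD)

lemma prefers_total: "prefers p a b \<or> a = b \<or> prefers p b a"
  using strict_linear_order_Rep_pref[of p]
  by (auto simp: prefers_def strict_linear_order_on_def total_on_def)

lemma pref_rank_mono:
  assumes "prefers p a b"
  shows "pref_rank p a < pref_rank p b"
proof -
  have "upper p a \<subset> upper p b"
    using assms prefers_irrefl[of p a] by (auto simp: upper_def dest: prefers_trans)
  then show ?thesis by (simp add: pref_rank_def psubset_card_mono)
qed

lemma pref_rank_less_iff: "pref_rank p a < pref_rank p b \<longleftrightarrow> prefers p a b"
  using pref_rank_mono[of p a b] pref_rank_mono[of p b a] prefers_total[of p a b] by auto

lemma pref_rank_le_card: "pref_rank (p :: 'a::finite pref) a \<le> CARD('a)"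
proof -
  have "upper p a \<subset> UNIV"
    using prefers_irrefl[of p a] by (auto simp: upper_def)
  then have "card (upper p a) < CARD('a)" by (intro psubset_card_mono) auto
  then show ?thesis by (simp add: pref_rank_def)
qed

lemma pref_rank_pos: "0 < pref_rank p a"
  by (simp add: pref_rank_def)

lemma upper_eq_sum:
  fixes f :: "'a::finite \<Rightarrow> real"
  shows "sum f (upper_eq p a) = sum f (upper p a) + f a"
  using prefers_irrefl[of p a] by (simp add: upper_eq_def upper_def)

section \<open>Equal-speed division of one object\<close>

lemma pr_share_cong:
  assumes "\<And>j. j \<in> I \<Longrightarrow> r j = r' j" "i \<in> I"
  shows "pr_share r s I i = pr_share r' s I i"
proof -
  have "(\<Sum>j\<in>I. min (r j) l) = (\<Sum>j\<in>I. min (r' j) l)" for l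
    using assms(1) by (intro sum.cong) auto
  moreover have "sum r I = sum r' I" using assms(1) by (intro sum.cong) auto
  ultimately show ?thesis using assms by (simp add: pr_share_def)
qed

text \<open>Hides the description operator: later arguments only need that the shares are capped by
  a common level and that they add up to \<open>s\<close>.\<close>

lemma pr_share_cases:
  assumes "finite I" "\<And>j. j \<in> I \<Longrightarrow> 0 \<le> r j" "0 \<le> s"
  obtains (satiated) "\<And>i. pr_share r s I i = r i"
  | (exhausted) l where "\<And>i. pr_share r s I i = min (r i) l" "(\<Sum>i\<in>I. pr_share r s I i) = s"
proof (cases "sum r I \<le> s")
  case True
  then show thesis by (intro satiated) (simp add: pr_share_def)
next
  case False
  define l where "l = (THE l. l \<ge> 0 \<and> (\<Sum>j\<in>I. min (r j) l) = s)"
  have "(\<Sum>j\<in>I. min (r j) l) = s"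
    unfolding l_def using theI'[OF pr_level_ex1[of I r s]] assms False by auto
  moreover have "pr_share r s I i = min (r i) l" for i
    using False by (simp add: pr_share_def l_def)
  ultimately show thesis by (intro exhausted) auto
qed

text \<open>The largest share serves as the level: by \<open>fair\<close>, whoever stays below it is
  satiated, so \<open>y\<close> is the minimum of demand and level throughout
  \<open>I\<close>.\<close>

lemma pr_share_eqI:
  assumes fin: "finite I"
    and y: "\<And>j. j \<in> I \<Longrightarrow> 0 \<le> y j" "\<And>j. j \<in> I \<Longrightarrow> y j \<le> r j"
    and le: "sum y I \<le> s"
    and exhaust: "\<And>j. j \<in> I \<Longrightarrow> y j < r j \<Longrightarrow> sum y I = s"
    and fair: "\<And>i j. i \<in> I \<Longrightarrow> j \<in> I \<Longrightarrow> y i < y j \<Longrightarrow> y i = r i"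
    and i: "i \<in> I"
  shows "pr_share r s I i = y i"
proof (cases "sum r I \<le> s")
  case True
  have "y i = r i"
  proof (rule ccontr)
    assume "y i \<noteq> r i"
    then have *: "y i < r i" using y i by force
    then have "sum y I < sum r I" using fin i y by (intro sum_strict_mono_ex1) auto
    with exhaust[OF i *] True show False by simp
  qed
  then show ?thesis using True by (simp add: pr_share_def)
next
  case False
  define l where "l = Max (y ` I)"
  have "l \<in> y ` I" unfolding l_def using fin i by (intro Max_in) auto
  then obtain m where m: "m \<in> I" "l = y m" by blast
  have y_le: "y j \<le> l" if "j \<in> I" for j
    unfolding l_def using fin that by auto
  have y_eq: "y j = min (r j) l" if "j \<in> I" for j
    using fair[of j m] y(2)[of j] y_le[of j] that m by linarith
  \<comment> \<open>If all demands were met, \<open>y\<close> would distribute more than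
    \<open>s\<close>. So somebody is unsatiated, which makes \<open>exhaust\<close>
    applicable.\<close>
  have "\<exists>j\<in>I. y j < r j"
  proof (rule ccontr)
    assume "\<not> ?thesis"
    then have "sum r I \<le> sum y I" by (intro sum_mono) force
    with le False show False by simp
  qed
  then have sum: "sum y I = s" using exhaust by blast
  have l: "l \<ge> 0 \<and> (\<Sum>j\<in>I. min (r j) l) = s"
  proof
    show "0 \<le> l" using y(1) m by simp
    have "(\<Sum>j\<in>I. min (r j) l) = sum y I" by (intro sum.cong refl y_eq[symmetric])
    then show "(\<Sum>j\<in>I. min (r j) l) = s" using sum by simp
  qed
  have "\<exists>!l. l \<ge> 0 \<and> (\<Sum>j\<in>I. min (r j) l) = s"
  proof (rule pr_level_ex1[OF fin])
    show "0 \<le> r j" if "j \<in> I" for j using y that by force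
    show "0 \<le> s" using sum y(1) sum_nonneg[of I y] by simp
  qed (use False in simp)
  then have "(THE l. l \<ge> 0 \<and> (\<Sum>j\<in>I. min (r j) l) = s) = l"
    using l by (rule the1_equality)
  then show ?thesis using False y_eq[OF i] by (simp add: pr_share_def)
qed

section \<open>The PR outcome as solution of a system of equations\<close>

definition pr_demand :: "('i, 'a) profile \<Rightarrow> ('i, 'a::finite) assignment \<Rightarrow> 'a \<Rightarrow> 'i \<Rightarrow> real" where
  "pr_demand P x a j = 1 - sum (x j) (upper (P j) a)"

definition pr_supply ::
  "('a::finite \<Rightarrow> nat) \<Rightarrow> ('i::finite, 'a) profile \<Rightarrow> ('i, 'a) assignment \<Rightarrow> 'a \<Rightarrow> nat \<Rightarrow> real" where
  "pr_supply q P x a k = real (q a) - (\<Sum>j | pref_rank (P j) a < k. x j a)"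

text \<open>The right-hand side looks only at entries of \<open>x\<close> of rank below
  \<open>pref_rank (P i) a\<close>: for agents placing \<open>a\<close> at rank \<open>k\<close>,
  the better objects are exactly those of rank below \<open>k\<close>. The apparent fixed-point
  equation is therefore a recursion on the rank.\<close>

definition pr_consistent ::
  "('a::finite \<Rightarrow> nat) \<Rightarrow> ('i::finite, 'a) profile \<Rightarrow> ('i, 'a) assignment \<Rightarrow> bool" where
  "pr_consistent q P x \<longleftrightarrow> (\<forall>i a. x i a =
     pr_share (pr_demand P x a) (pr_supply q P x a (pref_rank (P i) a))
       {j. pref_rank (P j) a = pref_rank (P i) a} i)"

lemma pr_consistentD:
  assumes "pr_consistent q P x" "pref_rank (P i) a = k"
  shows "x i a = pr_share (pr_demand P x a) (pr_supply q P x a k) {j. pref_rank (P j) a = k} i"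
  using assms unfolding pr_consistent_def by blast

lemma pr_upto_before: "k < pref_rank (P i) a \<Longrightarrow> pr_upto q P k i a = 0"
  by (induction k) auto

lemma pr_upto_after:
  "pref_rank (P i) a \<le> k \<Longrightarrow> pr_upto q P k i a = pr_upto q P (pref_rank (P i) a) i a"
  by (induction k rule: dec_induct) auto

text \<open>Each entry is written once, at the step equal to its rank. No rank exceeds
  \<open>CARD('a)\<close>, so the value written then is the final one.\<close>

lemma pr_upto_eq:
  "pr_upto q P k i a = (if pref_rank (P i) a \<le> k then pr_rule q P i a else 0)"
  using pr_upto_before[of k P i a q] pr_upto_after[of P i a k q]
    pr_upto_after[OF pref_rank_le_card, of q P i a]
  by (auto simp: pr_rule_def)

text \<open>The state after step \<open>k\<close> is the final outcome cut off at rank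
  \<open>k\<close>, so the demands and the supply that the algorithm sees are those computed from
  the outcome itself.\<close>

lemma pr_consistent_pr_rule: "pr_consistent q P (pr_rule q P)"
  unfolding pr_consistent_def
proof (intro allI)
  fix i a
  define x where "x = pr_rule q P"
  \<comment> \<open>Ranks start at 1, so the entry is produced by a \<open>Suc\<close> step, from
    the state after step \<open>k\<close>.\<close>
  obtain k where k: "pref_rank (P i) a = Suc k"
    using pref_rank_pos[of "P i" a] by (metis gr0_implies_Suc)
  have upto: "pr_upto q P k = (\<lambda>j b. if pref_rank (P j) b < Suc k then x j b else 0)"
    by (auto simp: fun_eq_iff pr_upto_eq x_def)
  have "x i a = pr_upto q P (Suc k) i a"
    by (simp add: pr_upto_eq k x_def del: pr_upto.simps)
  also have "\<dots> = pr_share (\<lambda>j. 1 - (\<Sum>b\<in>UNIV. pr_upto q P k j b))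
      (real (q a) - (\<Sum>j\<in>UNIV. pr_upto q P k j a)) {j. pref_rank (P j) a = Suc k} i"
    by (simp add: k)
  also have "real (q a) - (\<Sum>j\<in>UNIV. pr_upto q P k j a) = pr_supply q P x a (Suc k)"
    by (simp add: upto pr_supply_def sum.inter_filter[symmetric])
  also have "pr_share (\<lambda>j. 1 - (\<Sum>b\<in>UNIV. pr_upto q P k j b)) (pr_supply q P x a (Suc k))
      {j. pref_rank (P j) a = Suc k} i
    = pr_share (pr_demand P x a) (pr_supply q P x a (Suc k)) {j. pref_rank (P j) a = Suc k} i"
  \<comment> \<open>The two demand functions need to agree only on agents who rank \<open>a\<close>
    at \<open>Suc k\<close>; for them the objects consumed in earlier steps are exactly those
    preferred to \<open>a\<close>.\<close>
  proof (rule pr_share_cong)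
    fix j assume "j \<in> {j. pref_rank (P j) a = Suc k}"
    then have "upper (P j) a = {b. pref_rank (P j) b < Suc k}"
      using pref_rank_less_iff[of "P j" _ a] by (auto simp: upper_def)
    then show "1 - (\<Sum>b\<in>UNIV. pr_upto q P k j b) = pr_demand P x a j"
      by (simp add: upto pr_demand_def sum.inter_filter[symmetric])
  qed (simp add: k)
  finally show "pr_rule q P i a = pr_share (pr_demand P (pr_rule q P) a)
      (pr_supply q P (pr_rule q P) a (pref_rank (P i) a))
      {j. pref_rank (P j) a = pref_rank (P i) a} i"
    by (simp add: x_def k)
qed

text \<open>Strong induction on the rank: supply and demands at rank \<open>k\<close> depend only on
  entries of smaller rank, on which both solutions agree.\<close>

lemma pr_consistent_unique:
  assumes x: "pr_consistent q P x" and y: "pr_consistent q P y"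
  shows "x = y"
proof -
  have "pref_rank (P i) a = k \<Longrightarrow> x i a = y i a" for k i a
  proof (induction k arbitrary: i a rule: less_induct)
    case (less k)
    have supply_eq: "pr_supply q P x a k = pr_supply q P y a k"
      unfolding pr_supply_def using less.IH by simp
    have demand: "pr_demand P x a j = pr_demand P y a j" if "pref_rank (P j) a = k" for j
    proof -
      have "sum (x j) (upper (P j) a) = sum (y j) (upper (P j) a)"
        using less.IH that by (intro sum.cong) (auto simp: upper_def pref_rank_less_iff[symmetric])
      then show ?thesis by (simp add: pr_demand_def)
    qed
    have "x i a = pr_share (pr_demand P x a) (pr_supply q P x a k) {j. pref_rank (P j) a = k} i"
      using pr_consistentD[OF x less.prems] .
    also have "\<dots> = pr_share (pr_demand P y a) (pr_supply q P y a k) {j. pref_rank (P j) a = k} i"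
      unfolding supply_eq by (rule pr_share_cong) (use demand less.prems in auto)
    also have "\<dots> = y i a"
      using pr_consistentD[OF y less.prems, symmetric] .
    finally show ?case .
  qed
  then show ?thesis by blast
qed

lemma pr_rule_unique: "pr_consistent q P x \<longleftrightarrow> x = pr_rule q P"
  using pr_consistent_pr_rule pr_consistent_unique by blast

section \<open>Satiation in a random assignment\<close>

lemma random_assignmentsD:
  fixes x :: "('i::finite, 'a::finite) assignment"
  assumes "x \<in> random_assignments q"
  shows "0 \<le> x i a" "(\<Sum>a\<in>UNIV. x i a) = 1" "(\<Sum>i\<in>UNIV. x i a) \<le> real (q a)"
  using assms by (auto simp: random_assignments_def)

lemma sum_upper_eq_le_1:
  assumes x: "x \<in> random_assignments q"
  shows "sum (x i) (upper_eq (P i) a) \<le> 1"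
proof -
  have "sum (x i) (upper_eq (P i) a) \<le> sum (x i) UNIV"
    by (rule sum_mono2) (auto intro: random_assignmentsD[OF x])
  then show ?thesis by (simp add: random_assignmentsD[OF x])
qed

lemma le_pr_demand_iff: "x i a \<le> pr_demand P x a i \<longleftrightarrow> sum (x i) (upper_eq (P i) a) \<le> 1"
  by (auto simp: pr_demand_def upper_eq_sum)

lemma eq_pr_demand_iff: "x i a = pr_demand P x a i \<longleftrightarrow> sum (x i) (upper_eq (P i) a) = 1"
  by (auto simp: pr_demand_def upper_eq_sum)

lemma satiated_imp_zero:
  assumes x: "x \<in> random_assignments q"
    and "sum (x i) (upper_eq (P i) a) = 1" "prefers (P i) a b"
  shows "x i b = 0"
proof -
  have "sum (x i) (UNIV - upper_eq (P i) a) = 0"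
    using assms random_assignmentsD(2)[OF x, of i] by (simp add: sum_diff)
  then have "\<forall>c\<in>UNIV - upper_eq (P i) a. x i c = 0"
    by (subst (asm) sum_nonneg_eq_0_iff) (auto intro: random_assignmentsD[OF x])
  moreover have "b \<notin> upper_eq (P i) a"
    using assms prefers_trans[of "P i" a b a] prefers_irrefl[of "P i" a]
    by (auto simp: upper_eq_def upper_def)
  ultimately show ?thesis by blast
qed

text \<open>Supplies the worse object whose positive probability triggers condition (i) of
  sd-rank-fairness.\<close>

lemma unsatiated_imp_pos:
  assumes x: "x \<in> random_assignments q"
    and less: "sum (x i) (upper_eq (P i) a) < 1"
  obtains b where "prefers (P i) a b" "0 < x i b"
proof -
  have "\<exists>b. b \<notin> upper_eq (P i) a \<and> x i b > 0"
  proof (rule ccontr)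
    assume "\<not> ?thesis"
    then have "\<forall>b\<in>UNIV - upper_eq (P i) a. x i b = 0"
      using random_assignmentsD(1)[OF x] by (force simp: not_less intro: antisym)
    then have "sum (x i) (upper_eq (P i) a) = sum (x i) UNIV"
      by (intro sum.mono_neutral_left) auto
    with less show False by (simp add: random_assignmentsD[OF x])
  qed
  then show thesis
    using prefers_total[of "P i" a] that by (auto simp: upper_eq_def upper_def)
qed

lemma sum_rank_split:
  fixes x :: "('i::finite, 'a::finite) assignment"
  shows "(\<Sum>j\<in>UNIV. x j a) = (\<Sum>j | pref_rank (P j) a < k. x j a)
    + (\<Sum>j | pref_rank (P j) a = k. x j a) + (\<Sum>j | pref_rank (P j) a > k. x j a)"
proof -
  have "(UNIV :: 'i set) = ({j. pref_rank (P j) a < k} \<union> {j. pref_rank (P j) a = k})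
      \<union> {j. pref_rank (P j) a > k}"
    by auto
  then have "(\<Sum>j\<in>UNIV. x j a) = sum (\<lambda>j. x j a) (({j. pref_rank (P j) a < k}
      \<union> {j. pref_rank (P j) a = k}) \<union> {j. pref_rank (P j) a > k})"
    by simp
  also have "\<dots> = (\<Sum>j | pref_rank (P j) a < k. x j a)
    + (\<Sum>j | pref_rank (P j) a = k. x j a) + (\<Sum>j | pref_rank (P j) a > k. x j a)"
    by (subst sum.union_disjoint; (subst sum.union_disjoint)?; force)
  finally show ?thesis .
qed

section \<open>The two axioms at a single profile\<close>

text \<open>Neither axiom relates different profiles, so the characterisation can be proved for one
  assignment at one fixed profile.\<close>

definition sd_rank_fair_at ::
  "('a::finite \<Rightarrow> nat) \<Rightarrow> ('i::finite, 'a) profile \<Rightarrow> ('i, 'a) assignment \<Rightarrow> bool" where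
  "sd_rank_fair_at q P x \<longleftrightarrow> (\<forall>i a. x i a > 0 \<longrightarrow>
     (\<forall>a'. prefers (P i) a' a \<longrightarrow> (\<Sum>j\<in>UNIV. x j a') = real (q a')) \<and>
     (\<forall>j. pref_rank (P j) a < pref_rank (P i) a \<longrightarrow> sum (x j) (upper_eq (P j) a) = 1))"

definition equal_rank_envy_free_at ::
  "('i::finite, 'a::finite) profile \<Rightarrow> ('i, 'a) assignment \<Rightarrow> bool" where
  "equal_rank_envy_free_at P x \<longleftrightarrow> (\<forall>a i j. pref_rank (P i) a = pref_rank (P j) a \<longrightarrow>
     min (sum (x i) (upper (P i) a) + x j a) 1 \<le> sum (x i) (upper_eq (P i) a))"

lemma fair_imp_pr_consistent:
  assumes x: "x \<in> random_assignments q"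
    and fair: "sd_rank_fair_at q P x" and envy: "equal_rank_envy_free_at P x"
  shows "pr_consistent q P x"
  unfolding pr_consistent_def
proof (intro allI)
  fix i a
  define k where "k = pref_rank (P i) a"
  let ?I = "{j. pref_rank (P j) a = k}"
  note split = sum_rank_split[of x a P k]
  have "pr_share (pr_demand P x a) (pr_supply q P x a k) ?I i = x i a"
  proof (rule pr_share_eqI)
    show "0 \<le> x j a" for j by (rule random_assignmentsD[OF x])
    show le: "x j a \<le> pr_demand P x a j" for j
      unfolding le_pr_demand_iff by (rule sum_upper_eq_le_1[OF x])
    have "0 \<le> (\<Sum>j | pref_rank (P j) a > k. x j a)"
      by (intro sum_nonneg random_assignmentsD[OF x])
    then show "(\<Sum>j\<in>?I. x j a) \<le> pr_supply q P x a k"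
      using split random_assignmentsD(3)[OF x, of a] by (simp add: pr_supply_def)
  next
    fix j assume j: "j \<in> ?I" and "x j a < pr_demand P x a j"
    then have less: "sum (x j) (upper_eq (P j) a) < 1"
      by (simp add: pr_demand_def upper_eq_sum)
    then obtain b where "prefers (P j) a b" "0 < x j b"
      by (rule unsatiated_imp_pos[OF x])
    then have total: "(\<Sum>j\<in>UNIV. x j a) = real (q a)"
      using fair unfolding sd_rank_fair_at_def by blast
    have "x h a = 0" if "pref_rank (P h) a > k" for h
    proof (rule ccontr)
      assume "x h a \<noteq> 0"
      then have "0 < x h a" using random_assignmentsD(1)[OF x, of h a] by simp
      moreover have "pref_rank (P j) a < pref_rank (P h) a" using j that by simp
      ultimately have "sum (x j) (upper_eq (P j) a) = 1"
        using fair unfolding sd_rank_fair_at_def by blast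
      with less show False by simp
    qed
    then show "(\<Sum>j\<in>?I. x j a) = pr_supply q P x a k"
      using split total by (simp add: pr_supply_def)
  next
    \<comment> \<open>Since \<open>x j a\<close> exceeds \<open>x h a\<close>, the first argument of
      the minimum is larger than the right-hand side. The minimum must then be 1, that is,
      \<open>h\<close> is satiated.\<close>
    fix h j assume "h \<in> ?I" "j \<in> ?I" "x h a < x j a"
    moreover from this
    have "min (sum (x h) (upper (P h) a) + x j a) 1 \<le> sum (x h) (upper_eq (P h) a)"
      using envy unfolding equal_rank_envy_free_at_def by simp
    ultimately show "x h a = pr_demand P x a h"
      using sum_upper_eq_le_1[OF x, of h P a]
      unfolding eq_pr_demand_iff by (auto simp: upper_eq_sum min_def split: if_splits)
  qed (simp_all add: k_def)
  then show "x i a = pr_share (pr_demand P x a) (pr_supply q P x a (pref_rank (P i) a))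
      {j. pref_rank (P j) a = pref_rank (P i) a} i"
    by (simp add: k_def)
qed

text \<open>If rank \<open>k\<close> uses up what the lower ranks leave of \<open>a\<close>, the
  quota is already reached, and feasibility leaves nothing for agents ranking \<open>a\<close> after
  \<open>k\<close>.\<close>

lemma pr_consistent_cases:
  assumes x: "x \<in> random_assignments q" and con: "pr_consistent q P x"
  obtains (satiated) "\<And>i. pref_rank (P i) a = k \<Longrightarrow> sum (x i) (upper_eq (P i) a) = 1"
  | (exhausted) l where "\<And>i. pref_rank (P i) a = k \<Longrightarrow> x i a = min (pr_demand P x a i) l"
      "(\<Sum>j\<in>UNIV. x j a) = real (q a)" "\<And>i. pref_rank (P i) a > k \<Longrightarrow> x i a = 0"
proof -
  let ?I = "{j. pref_rank (P j) a = k}"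
  let ?share = "pr_share (pr_demand P x a) (pr_supply q P x a k) ?I"
  note split = sum_rank_split[of x a P k]
  have nonneg: "0 \<le> (\<Sum>j\<in>J. x j a)" for J
    by (simp add: sum_nonneg random_assignmentsD(1)[OF x])
  have share: "x i a = ?share i" if "pref_rank (P i) a = k" for i
    using pr_consistentD[OF con that] .
  have demand: "0 \<le> pr_demand P x a j" for j
    using sum_upper_eq_le_1[OF x, of j P a] random_assignmentsD(1)[OF x, of j a]
    unfolding le_pr_demand_iff[symmetric] by linarith
  have supply_nonneg: "0 \<le> pr_supply q P x a k"
    using split nonneg[of ?I] nonneg[of "{j. pref_rank (P j) a > k}"]
      random_assignmentsD(3)[OF x, of a] unfolding pr_supply_def by linarith
  show thesis
  proof (rule pr_share_cases[of ?I "pr_demand P x a" "pr_supply q P x a k"])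
    assume "\<And>i. ?share i = pr_demand P x a i"
    then show thesis
      by (intro satiated) (simp add: share flip: eq_pr_demand_iff)
  next
    fix l assume l: "\<And>i. ?share i = min (pr_demand P x a i) l"
      and "sum ?share ?I = pr_supply q P x a k"
    then have "(\<Sum>j\<in>?I. x j a) = pr_supply q P x a k"
      using sum.cong[of ?I ?I "\<lambda>j. x j a" ?share] share by simp
    then have *: "(\<Sum>j\<in>UNIV. x j a) = real (q a)"
      "(\<Sum>j | pref_rank (P j) a > k. x j a) = 0"
      using split nonneg[of "{j. pref_rank (P j) a > k}"] random_assignmentsD(3)[OF x, of a]
      unfolding pr_supply_def by linarith+
    have "x i a = 0" if "pref_rank (P i) a > k" for i
      using *(2) that
      by (subst (asm) sum_nonneg_eq_0_iff) (auto intro: random_assignmentsD[OF x])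
    then show thesis using l share * by (intro exhausted[of l]) auto
  qed (use demand supply_nonneg in auto)
qed

text \<open>Each condition rules out one case of the dichotomy. For (i), \<open>i\<close> cannot be
  satiated at \<open>a'\<close> while receiving the worse \<open>a\<close>. For (ii),
  \<open>a\<close> cannot be exhausted at the rank \<open>j\<close> gives it, because
  \<open>i\<close> still gets some at a later rank.\<close>

lemma pr_consistent_imp_sd_rank_fair_at:
  assumes x: "x \<in> random_assignments q" and con: "pr_consistent q P x"
  shows "sd_rank_fair_at q P x"
  unfolding sd_rank_fair_at_def
proof (intro allI impI conjI)
  fix i a a' assume "0 < x i a" "prefers (P i) a' a"
  then have "sum (x i) (upper_eq (P i) a') \<noteq> 1"
    using satiated_imp_zero[OF x, of i P a' a] by auto
  then show "(\<Sum>j\<in>UNIV. x j a') = real (q a')"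
    by (cases rule: pr_consistent_cases[OF x con, of a' "pref_rank (P i) a'"]) auto
next
  fix i a j assume "0 < x i a" "pref_rank (P j) a < pref_rank (P i) a"
  then show "sum (x j) (upper_eq (P j) a) = 1"
    by (cases rule: pr_consistent_cases[OF x con, of a "pref_rank (P j) a"]) auto
qed

text \<open>With a common level \<open>l\<close>, agent \<open>j\<close> gets at most
  \<open>l\<close>, and \<open>i\<close> gets either \<open>l\<close> or the whole remaining demand,
  which means satiation.\<close>

lemma pr_consistent_imp_equal_rank_envy_free_at:
  assumes x: "x \<in> random_assignments q" and con: "pr_consistent q P x"
  shows "equal_rank_envy_free_at P x"
  unfolding equal_rank_envy_free_at_def
proof (intro allI impI)
  fix a i j assume rank: "pref_rank (P i) a = pref_rank (P j) a"
  show "min (sum (x i) (upper (P i) a) + x j a) 1 \<le> sum (x i) (upper_eq (P i) a)"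
  proof (cases rule: pr_consistent_cases[OF x con, of a "pref_rank (P i) a"])
    case 1
    then show ?thesis by simp
  next
    case (2 l)
    then have "x i a = min (pr_demand P x a i) l" "x j a \<le> l" using rank by auto
    then show ?thesis by (auto simp: upper_eq_sum pr_demand_def min_def split: if_splits)
  qed
qed

section \<open>From single profiles to rules\<close>

lemma fair_iff_pr_rule:
  assumes "x \<in> random_assignments q"
  shows "sd_rank_fair_at q P x \<and> equal_rank_envy_free_at P x \<longleftrightarrow> x = pr_rule q P"
  using fair_imp_pr_consistent[OF assms, of P] pr_consistent_imp_sd_rank_fair_at[OF assms, of P]
    pr_consistent_imp_equal_rank_envy_free_at[OF assms, of P] pr_rule_unique[of q P x] by blast

theorem theorem1:
  fixes q :: "'a::finite \<Rightarrow> nat" and \<phi> :: "('i::finite, 'a) rule"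
  assumes "\<forall>a. q a > 0"
    and "(\<Sum>a\<in>UNIV. q a) \<ge> CARD('i)"
    and "is_rule q \<phi>"
  shows "sd_rank_fair q \<phi> \<and> equal_rank_envy_free \<phi> \<longleftrightarrow> \<phi> = pr_rule q"
proof -
  have "sd_rank_fair q \<phi> \<longleftrightarrow> (\<forall>P. sd_rank_fair_at q P (\<phi> P))"
    unfolding sd_rank_fair_def sd_rank_fair_at_def by (rule refl)
  moreover have "equal_rank_envy_free \<phi> \<longleftrightarrow> (\<forall>P. equal_rank_envy_free_at P (\<phi> P))"
    unfolding equal_rank_envy_free_def equal_rank_envy_free_at_def by (rule refl)
  ultimately have "sd_rank_fair q \<phi> \<and> equal_rank_envy_free \<phi> \<longleftrightarrow>
      (\<forall>P. sd_rank_fair_at q P (\<phi> P) \<and> equal_rank_envy_free_at P (\<phi> P))"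
    by (simp only: all_conj_distrib)
  also have "\<dots> \<longleftrightarrow> (\<forall>P. \<phi> P = pr_rule q P)"
    using assms(3) fair_iff_pr_rule[of "\<phi> _" q] by (simp add: is_rule_def)
  finally show ?thesis by (simp only: fun_eq_iff[of \<phi>])
qed

end
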